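(* Let $V$, $M$, $O$ be real Hilbert spaces, let $b : V \times M \to \mathbb{R}$ be a continuous bilinear form, let $B : V \to M$ be defined by $(Bu, \lambda)_M = b(u,\lambda)$ for all $(u,\lambda) \in V \times M$, and let $C : V \to O$ be a continuous linear operator. Assume that $A : V \to H = M \times O$, $Au = (Bu, Cu)$, is injective. Let $f \in O$ and $\varepsilon > 0$. A pair $(u_\varepsilon, \lambda_\varepsilon) \in V \times M$ is the solution of the problem $$\begin{cases} \varepsilon (u_\varepsilon, v)_V + (C u_\varepsilon, C v)_O + b(v, \lambda_\varepsilon) = (f, Cv)_O, \\ b(u_\varepsilon, \mu) - (\lambda_\varepsilon, \mu)_M = 0, \end{cases} \quad \forall (v,\mu) \in V \times M,$$ if and only if $u_\varepsilon \in V$ is the solution of $$(A u_\varepsilon, A v)_H + \varepsilon (u_\varepsilon, v)_V = (g, A v)_H, \quad \forall v \in V,$$ for $g = (0, f) \in H$, and $\lambda_\varepsilon = B u_\varepsilon$.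
   Context: $H = M \times O$ is equipped with the scalar product $((\lambda,f),(\mu,h))_H = (\lambda,\mu)_M + (f,h)_O$. For each $\varepsilon>0$ both problems have a unique solution. *)

theory Defs
  imports "HOL-Analysis.Analysis"
begin

text \<open>
  Real Hilbert spaces are types of sort \<open>{real_inner, complete_space}\<close>.
  The scalar product of \<open>H = M \<times> O\<close> is the library's inner product on the product type,
  \<open>inner x y = inner (fst x) (fst y) + inner (snd x) (snd y)\<close>.
\<close>

definition solves_mixed ::
  "('v::real_inner \<Rightarrow> 'm::real_inner \<Rightarrow> real) \<Rightarrow> ('v \<Rightarrow> 'o::real_inner) \<Rightarrow> 'o \<Rightarrow> real
    \<Rightarrow> 'v \<Rightarrow> 'm \<Rightarrow> bool" where
  "solves_mixed b C f \<epsilon> u l \<longleftrightarrow>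
     (\<forall>v m. \<epsilon> * inner u v + inner (C u) (C v) + b v l = inner f (C v)
          \<and> b u m - inner l m = 0)"

definition solves_regularized ::
  "('v::real_inner \<Rightarrow> 'h::real_inner) \<Rightarrow> 'h \<Rightarrow> real \<Rightarrow> 'v \<Rightarrow> bool" where
  "solves_regularized A g \<epsilon> u \<longleftrightarrow>
     (\<forall>v. inner (A u) (A v) + \<epsilon> * inner u v = inner g (A v))"

end

theory Submission
  imports Defs
begin

text \<open>
  Testing the second mixed equation with every \<open>\<mu>\<close> says exactly that \<open>\<lambda> = B u\<close>. Eliminating
  \<open>\<lambda>\<close> turns the coupling term \<open>b v \<lambda>\<close> of the first equation into \<open>inner (B u) (B v)\<close>, which
  together with \<open>inner (C u) (C v)\<close> makes up \<open>inner (A u) (A v)\<close>; on the right, the vanishing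
  first component of \<open>(0, f)\<close> leaves \<open>inner f (C v)\<close>. So the mixed problem and the regularized
  problem are the same equation for \<open>u\<close>, and solvability need only be shown for the latter.

  The regularized problem consists of the normal equations of the Tikhonov functional
  \<open>\<parallel>A v - g\<parallel>\<^sup>2 + \<epsilon> \<parallel>v\<parallel>\<^sup>2\<close>. This functional is a plain least-squares residual
  \<open>\<parallel>T v - w\<parallel>\<^sup>2\<close> for the lifted operator \<open>T v = (sqrt \<epsilon> v, A v)\<close> with values in
  \<open>V \<times> H\<close> and the datum \<open>w = (0, g)\<close>. Since \<open>\<epsilon> > 0\<close>, the operator \<open>T\<close> is bounded below by
  \<open>sqrt \<epsilon>\<close>. For operators bounded below on a complete space, the parallelogram law makes
  minimizing sequences of the residual Cauchy (\<open>least_squares_minimizer_exists\<close>), minimizers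
  satisfy the normal equations (\<open>least_squares_minimizer_normal_equation\<close>), and the lower bound
  also forces uniqueness (\<open>normal_equation_unique_solution\<close>).
\<close>

section \<open>Least squares for operators bounded below\<close>

text \<open>
  This is the parallelogram law for \<open>T x - w\<close> and \<open>T y - w\<close>: half of their sum is the residual
  at the midpoint of \<open>x\<close> and \<open>y\<close>, so it cannot beat the lower bound \<open>D\<close>. Hence two nearly optimal
  points have nearly equal images.
\<close>
lemma near_minimizers_have_close_images:
  fixes T :: "'v::real_normed_vector \<Rightarrow> 'w::real_inner"
  assumes "bounded_linear T"
    and D: "\<And>v. D \<le> (norm (T v - w))\<^sup>2"
    and x: "(norm (T x - w))\<^sup>2 \<le> D + p"
    and y: "(norm (T y - w))\<^sup>2 \<le> D + q"
  shows "(norm (T (x - y)))\<^sup>2 \<le> 2 * p + 2 * q"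
proof -
  interpret T: bounded_linear T by fact
  define m where "m = T ((1/2) *\<^sub>R (x + y)) - w"
  have m: "2 *\<^sub>R m = (T x - w) + (T y - w)"
    by (simp add: m_def T.scaleR T.add algebra_simps scaleR_2)
  have "(norm (T (x - y)))\<^sup>2 + (norm (2 *\<^sub>R m))\<^sup>2
      = 2 * (norm (T x - w))\<^sup>2 + 2 * (norm (T y - w))\<^sup>2"
    unfolding m T.diff power2_norm_eq_inner
    by (simp add: inner_diff inner_add inner_commute algebra_simps)
  moreover have "(norm (2 *\<^sub>R m))\<^sup>2 = 4 * (norm m)\<^sup>2"
    by (simp add: power_mult_distrib)
  moreover have "D \<le> (norm m)\<^sup>2"
    unfolding m_def by (rule D)
  ultimately show ?thesis using x y by linarith
qed

text \<open>
  By the preceding estimate, the images of a minimizing sequence form a Cauchy sequence. The lower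
  bound on \<open>T\<close> pulls this back to the domain, whose completeness provides the limit.
\<close>
lemma least_squares_minimizer_exists:
  fixes T :: "'v::{real_normed_vector, complete_space} \<Rightarrow> 'w::real_inner"
  assumes T: "bounded_linear T"
    and c: "c > 0" "\<And>v. c * norm v \<le> norm (T v)"
  shows "\<exists>u. \<forall>v. norm (T u - w) \<le> norm (T v - w)"
proof -
  interpret T: bounded_linear T by (rule T)
  define R where "R v = (norm (T v - w))\<^sup>2" for v
  define D where "D = (INF v. R v)"
  have bdd: "bdd_below (range R)"
    by (rule bdd_belowI[of _ 0]) (auto simp: R_def)
  have D: "D \<le> R v" for v
    unfolding D_def by (rule cINF_lower[OF bdd]) simp
  have "\<exists>v. R v < D + inverse (real (Suc n))" for n
    using cINF_less_iff[OF _ bdd, of "D + inverse (real (Suc n))"]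
    by (simp add: D_def)
  then obtain x where x: "\<And>n. R (x n) < D + inverse (real (Suc n))"
    by metis
  have "Cauchy x"
  proof (rule CauchyI)
    fix e :: real
    assume e: "0 < e"
    \<comment> \<open>Beyond \<open>N\<close>, the bound \<open>2 * p + 2 * q\<close> of the parallelogram estimate is below \<open>(c e)\<^sup>2\<close>.\<close>
    obtain N where N: "inverse (real (Suc N)) < (c * e)\<^sup>2 / 4"
      using reals_Archimedean[of "(c * e)\<^sup>2 / 4"] c e by auto
    have near: "R (x n) \<le> D + inverse (real (Suc N))" if "N \<le> n" for n
    proof -
      have "inverse (real (Suc n)) \<le> inverse (real (Suc N))"
        using that by (simp add: le_imp_inverse_le)
      then show ?thesis using x[of n] by linarith
    qed
    have "norm (x m - x n) < e" if "N \<le> m" "N \<le> n" for m n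
    proof -
      have "(norm (T (x m - x n)))\<^sup>2
          \<le> 2 * inverse (real (Suc N)) + 2 * inverse (real (Suc N))"
        using near_minimizers_have_close_images[OF T] D near[OF that(1)] near[OF that(2)]
        unfolding R_def by blast
      also have "\<dots> < (c * e)\<^sup>2" using N by linarith
      finally have "norm (T (x m - x n)) < c * e"
        using c e by (auto intro: power2_less_imp_less)
      then have "c * norm (x m - x n) < c * e"
        using c(2) by (rule le_less_trans[rotated])
      then show ?thesis using c(1) by simp
    qed
    then show "\<exists>M. \<forall>m\<ge>M. \<forall>n\<ge>M. norm (x m - x n) < e" by blast
  qed
  then obtain u where u: "x \<longlonglongrightarrow> u"
    using Cauchy_convergent_iff convergent_def by blast
  have "(\<lambda>n. R (x n)) \<longlonglongrightarrow> R u"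
    unfolding R_def by (intro tendsto_intros T.tendsto u)
  moreover have "(\<lambda>n. D + inverse (real (Suc n))) \<longlonglongrightarrow> D + 0"
    by (intro tendsto_intros LIMSEQ_inverse_real_of_nat)
  ultimately have "R u \<le> D + 0"
    by (rule LIMSEQ_le) (use x in \<open>auto intro: less_imp_le\<close>)
  then have "R u \<le> R v" for v
    using D[of v] by linarith
  then show ?thesis
    unfolding R_def by auto
qed

text \<open>
  First-order optimality. Along the line \<open>u - t v\<close> the squared residual is a quadratic in \<open>t\<close>
  with linear coefficient \<open>-2 inner (T u - w) (T v)\<close>, which must vanish at a minimum.
\<close>
lemma least_squares_minimizer_normal_equation:
  fixes T :: "'v::real_normed_vector \<Rightarrow> 'w::real_inner"
  assumes "bounded_linear T"
    and min: "\<And>v. norm (T u - w) \<le> norm (T v - w)"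
  shows "inner (T u) (T v) = inner w (T v)"
proof (cases "T v = 0")
  case False
  interpret T: bounded_linear T by fact
  define s where "s = inner (T u - w) (T v)"
  define k where "k = inner (T v) (T v)"
  have k: "k > 0" using False by (simp add: k_def)
  have expand: "(norm (r - t *\<^sub>R z))\<^sup>2 = (norm r)\<^sup>2 - 2 * t * inner r z + t\<^sup>2 * inner z z"
    for r z :: 'w and t
    unfolding power2_norm_eq_inner
    by (simp add: inner_diff inner_commute power2_eq_square algebra_simps)
  \<comment> \<open>The step \<open>t = s / k\<close> minimizes the quadratic and lowers its value by \<open>s\<^sup>2 / k\<close>.\<close>
  have "(norm (T u - w))\<^sup>2 \<le> (norm (T (u - (s / k) *\<^sub>R v) - w))\<^sup>2"
    by (intro power_mono min) simp
  also have "T (u - (s / k) *\<^sub>R v) - w = (T u - w) - (s / k) *\<^sub>R T v"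
    by (simp add: T.diff T.scaleR)
  also have "(norm \<dots>)\<^sup>2 = (norm (T u - w))\<^sup>2 - 2 * (s / k) * s + (s / k)\<^sup>2 * k"
    unfolding s_def k_def by (rule expand)
  also have "\<dots> = (norm (T u - w))\<^sup>2 - s\<^sup>2 / k"
    using k by (simp add: power2_eq_square)
  finally have "s\<^sup>2 \<le> 0"
    using k by (simp add: divide_le_0_iff)
  then have "s = 0" by simp
  then show ?thesis by (simp add: s_def inner_diff_left)
qed simp

lemma normal_equation_unique_solution:
  fixes T :: "'v::{real_normed_vector, complete_space} \<Rightarrow> 'w::real_inner"
  assumes T: "bounded_linear T"
    and c: "c > 0" "\<And>v. c * norm v \<le> norm (T v)"
  shows "\<exists>!u. \<forall>v. inner (T u) (T v) = inner w (T v)"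
proof (rule ex_ex1I)
  show "\<exists>u. \<forall>v. inner (T u) (T v) = inner w (T v)"
    using least_squares_minimizer_exists[OF T c]
      least_squares_minimizer_normal_equation[OF T] by blast
next
  fix x y
  assume x: "\<forall>v. inner (T x) (T v) = inner w (T v)"
    and y: "\<forall>v. inner (T y) (T v) = inner w (T v)"
  interpret T: bounded_linear T by (rule T)
  have "inner (T (x - y)) (T (x - y)) = 0"
    using x y by (simp only: T.diff[of x y] inner_diff_left) (simp flip: T.diff)
  then have "c * norm (x - y) \<le> 0"
    using c(2)[of "x - y"] by simp
  then show "x = y"
    using c(1) by (simp add: mult_le_0_iff)
qed

section \<open>The regularized problem\<close>

text \<open>
  The penalty is absorbed into the operator \<open>T v = (sqrt \<epsilon> v, A v)\<close>, whose
  first component bounds it below by \<open>sqrt \<epsilon>\<close>; the regularized problem for \<open>A\<close> and \<open>g\<close> then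
  consists of the normal equations for \<open>T\<close> and \<open>(0, g)\<close>.
\<close>
lemma regularized_problem_unique_solution:
  fixes A :: "'v::{real_inner, complete_space} \<Rightarrow> 'h::real_inner"
  assumes A: "bounded_linear A" and eps: "\<epsilon> > 0"
  shows "\<exists>!u. solves_regularized A g \<epsilon> u"
proof -
  define T where "T v = (sqrt \<epsilon> *\<^sub>R v, A v)" for v
  have T: "bounded_linear T"
    unfolding T_def by (intro bounded_linear_Pair bounded_linear_scaleR_right A)
  have "sqrt \<epsilon> * norm v \<le> norm (T v)" for v
    using norm_fst_le[of "sqrt \<epsilon> *\<^sub>R v" "A v"] eps by (simp add: T_def)
  moreover have "sqrt \<epsilon> > 0" using eps by simp
  ultimately have "\<exists>!u. \<forall>v. inner (T u) (T v) = inner (0, g) (T v)"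
    using normal_equation_unique_solution[OF T] by blast
  moreover have "inner (T u) (T v) = inner (A u) (A v) + \<epsilon> * inner u v" for u v
    using eps by (simp add: T_def)
  moreover have "inner (0, g) (T v) = inner g (A v)" for v
    by (simp add: T_def)
  ultimately show ?thesis
    unfolding solves_regularized_def by simp
qed

section \<open>Eliminating the multiplier\<close>

text \<open>
  Linearity of \<open>B\<close> holds because vectors are determined by their inner products. The bound comes
  from testing with \<open>l = B u\<close>: \<open>\<parallel>B u\<parallel>\<^sup>2 = b u (B u) \<le> K \<parallel>u\<parallel> \<parallel>B u\<parallel>\<close>.
\<close>
lemma bounded_linear_representing_operator:
  fixes b :: "'v::real_normed_vector \<Rightarrow> 'm::real_inner \<Rightarrow> real"
  assumes "bounded_bilinear b"
    and B: "\<And>u l. inner (B u) l = b u l"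
  shows "bounded_linear B"
proof -
  interpret b: bounded_bilinear b by fact
  obtain K where K0: "0 \<le> K" and K: "\<And>u l. norm (b u l) \<le> norm u * norm l * K"
    using b.nonneg_bounded by blast
  show ?thesis
  proof (rule bounded_linear_intro[where K = K])
    show "B (x + y) = B x + B y" for x y
      by (rule vector_eq_rdot[THEN iffD1]) (simp add: inner_add_left B b.add_left)
    show "B (r *\<^sub>R x) = r *\<^sub>R B x" for r x
      by (rule vector_eq_rdot[THEN iffD1]) (simp add: B b.scaleR_left)
    show "norm (B x) \<le> norm x * K" for x
    proof (cases "B x = 0")
      case True
      then show ?thesis using K0 by simp
    next
      case False
      have "norm (B x) * norm (B x) = b x (B x)"
        by (simp flip: B power2_norm_eq_inner power2_eq_square)
      also have "\<dots> \<le> (norm x * K) * norm (B x)"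
        using K[of x "B x"] by (simp add: algebra_simps)
      finally show ?thesis using False by simp
    qed
  qed
qed

text \<open>
  The second mixed equation identifies \<open>l\<close> with \<open>B u\<close>; with this value, the first one is the
  regularized equation term by term.
\<close>
lemma solves_mixed_iff_solves_regularized:
  fixes b :: "'v::real_inner \<Rightarrow> 'm::real_inner \<Rightarrow> real"
    and C :: "'v \<Rightarrow> 'o::real_inner"
  assumes B: "\<And>u l. inner (B u) l = b u l"
  shows "solves_mixed b C f \<epsilon> u l
    \<longleftrightarrow> solves_regularized (\<lambda>v. (B v, C v)) (0, f) \<epsilon> u \<and> l = B u"
proof -
  have "(\<forall>m. b u m - inner l m = 0) \<longleftrightarrow> l = B u"
    using vector_eq_rdot[of l "B u"] by (auto simp flip: B)
  moreover have "b v (B u) = inner (B u) (B v)" for v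
    by (simp add: inner_commute flip: B)
  ultimately show ?thesis
    unfolding solves_mixed_def solves_regularized_def by (auto simp: algebra_simps)
qed

theorem proposition3p1:
  fixes b :: "'v::{real_inner, complete_space} \<Rightarrow> 'm::{real_inner, complete_space} \<Rightarrow> real"
    and B :: "'v \<Rightarrow> 'm"
    and C :: "'v \<Rightarrow> 'o::{real_inner, complete_space}"
    and A :: "'v \<Rightarrow> 'm \<times> 'o"
    and f :: 'o
    and \<epsilon> :: real
  assumes b: "bounded_bilinear b"
    and B: "\<And>u l. inner (B u) l = b u l"
    and C: "bounded_linear C"
    and A: "\<And>u. A u = (B u, C u)"
    and inj_A: "inj A"
    and eps: "\<epsilon> > 0"
  shows "(\<exists>!p. solves_mixed b C f \<epsilon> (fst p) (snd p)) \<and>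
         (\<exists>!u. solves_regularized A (0, f) \<epsilon> u) \<and>
         (\<forall>u l. solves_mixed b C f \<epsilon> u l \<longleftrightarrow> solves_regularized A (0, f) \<epsilon> u \<and> l = B u)"
proof -
  have A_eq: "A = (\<lambda>v. (B v, C v))" using A by (rule ext)
  have "bounded_linear A"
    unfolding A_eq by (intro bounded_linear_Pair bounded_linear_representing_operator[OF b B] C)
  then have regularized: "\<exists>!u. solves_regularized A (0, f) \<epsilon> u"
    by (rule regularized_problem_unique_solution[OF _ eps])
  have equiv: "solves_mixed b C f \<epsilon> u l \<longleftrightarrow> solves_regularized A (0, f) \<epsilon> u \<and> l = B u" for u l
    unfolding A_eq by (rule solves_mixed_iff_solves_regularized[OF B])
  have "\<exists>!p. solves_mixed b C f \<epsilon> (fst p) (snd p)"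
    using regularized unfolding equiv by (metis fst_conv snd_conv prod.collapse)
  with regularized equiv show ?thesis by blast
qed

end
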